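(* For all integers $m,n\ge 2$, ${\rm gp}_{\rm S}(K_m,K_n)=m(n-1)$.
   Context: A set $X$ of vertices of a connected graph is a general position set if no shortest path contains more than two vertices of $X$; ${\rm gp}$ denotes the maximum cardinality of a general position set. For graphs $G,H$ and $f\colon V(G)\to V(H)$, the Sierpiński product $G\otimes_f H$ has vertex set $V(G)\times V(H)$ and edges $(g,h)(g,h')$ for $g\in V(G)$, $hh'\in E(H)$, and $(g,f(g'))(g',f(g))$ for $gg'\in E(G)$. ${\rm gp}_{\rm S}(G,H)=\max_f{\rm gp}(G\otimes_f H)$ over all functions $f\colon V(G)\to V(H)$. $K_m$ is the complete graph on $m$ vertices. *)

theory Defs
  imports "Graph_Theory.Graph_Theory" "Graph_Theory.Kuratowski" "HOL-Library.FuncSet"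
begin

text \<open>
  Finite simple graphs are symmetric loop-free pair digraphs (locale \<^locale>\<open>pair_graph\<close>): an
  undirected edge \<open>uv\<close> is the pair of arcs \<open>(u,v)\<close>, \<open>(v,u)\<close>.
\<close>

definition shortest_vpath :: "'a list \<Rightarrow> 'a pair_pre_digraph \<Rightarrow> bool" where
  "shortest_vpath p G \<longleftrightarrow> vpath p (with_proj G) \<and>
    (\<forall>q. vpath q (with_proj G) \<and> hd q = hd p \<and> last q = last p \<longrightarrow>
      vwalk_length p \<le> vwalk_length q)"

definition general_position_set :: "'a pair_pre_digraph \<Rightarrow> 'a set \<Rightarrow> bool" where
  "general_position_set G X \<longleftrightarrow> X \<subseteq> pverts G \<and>
    (\<forall>p. shortest_vpath p G \<longrightarrow> card (set p \<inter> X) \<le> 2)"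

text \<open>Meaningful for finite graphs only, where the maximum ranges over a finite nonempty set.\<close>

definition gp :: "'a pair_pre_digraph \<Rightarrow> nat" where
  "gp G = Max (card ` {X. general_position_set G X})"

definition sierpinski_product ::
    "'a pair_pre_digraph \<Rightarrow> ('a \<Rightarrow> 'b) \<Rightarrow> 'b pair_pre_digraph \<Rightarrow> ('a \<times> 'b) pair_pre_digraph" where
  "sierpinski_product G f H =
    \<lparr> pverts = pverts G \<times> pverts H,
      parcs = {((g, h), (g, h')) | g h h'. g \<in> pverts G \<and> (h, h') \<in> parcs H}
            \<union> {((g, f g'), (g', f g)) | g g'. (g, g') \<in> parcs G} \<rparr>"

text \<open>
  Functions from \<open>V(G)\<close> to \<open>V(H)\<close> are taken extensional, so that there are only finitely many of
  them; \<^const>\<open>sierpinski_product\<close> depends on \<open>f\<close> only through its values on \<open>V(G)\<close>.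
\<close>

definition gp_S :: "'a pair_pre_digraph \<Rightarrow> 'b pair_pre_digraph \<Rightarrow> nat" where
  "gp_S G H = Max ((\<lambda>f. gp (sierpinski_product G f H)) ` (pverts G \<rightarrow>\<^sub>E pverts H))"

lemma pair_graph_sierpinski_product:
  assumes "pair_graph G" "pair_graph H" "f \<in> pverts G \<rightarrow> pverts H"
  shows "pair_graph (sierpinski_product G f H)"
proof -
  interpret G: pair_graph G by fact
  interpret H: pair_graph H by fact
  let ?S = "sierpinski_product G f H"
  have wf: "parcs ?S \<subseteq> pverts ?S \<times> pverts ?S"
    using assms(3) by (auto simp: sierpinski_product_def dest: G.in_arcsD1 G.in_arcsD2
        H.in_arcsD1 H.in_arcsD2)
  have fin: "finite (pverts ?S)"
    using G.pair_finite_verts H.pair_finite_verts by (simp add: sierpinski_product_def)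
  have sG: "(v, u) \<in> parcs G" if "(u, v) \<in> parcs G" for u v
    using that G.pair_sym_arcs by (auto simp: symmetric_def dest: symD)
  have sH: "(v, u) \<in> parcs H" if "(u, v) \<in> parcs H" for u v
    using that H.pair_sym_arcs by (auto simp: symmetric_def dest: symD)
  have sym: "sym (parcs ?S)"
    by (rule symI) (use sG sH in \<open>fastforce simp: sierpinski_product_def\<close>)
  have loops: "fst e \<noteq> snd e" if "e \<in> parcs ?S" for e
    using that G.pair_no_loops H.pair_no_loops by (fastforce simp: sierpinski_product_def)
  show ?thesis
  proof unfold_locales
    show "fst e \<in> pverts ?S" "snd e \<in> pverts ?S" if "e \<in> parcs ?S" for e
      using that wf by auto
    show "finite (parcs ?S)" using finite_subset[OF wf] fin by simp
    show "symmetric (with_proj ?S)" using sym by (simp add: symmetric_def)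
  qed (use fin loops in simp_all)
qed

end

theory Submission
  imports Defs
begin

text \<open>
  For a constant \<open>f\<close> with value \<open>h\<^sub>0\<close>, a vertex \<open>(g, h)\<close> with \<open>h \<noteq> h\<^sub>0\<close> has all its neighbours in
  its own fibre, which is a clique, so it is never an inner vertex of a shortest path; hence all
  these \<open>m (n - 1)\<close> vertices are in general position.

  Conversely, a general position set \<open>X\<close> with more than \<open>m (n - 1)\<close> elements contains a whole fibre,
  say that of \<open>g\<close>. If \<open>(g', h') \<in> X\<close> lies in another fibre, then the path from \<open>(g, a)\<close> to \<open>(g', h')\<close>
  through the edge joining the two fibres contains three elements of \<open>X\<close> for every
  \<open>a \<noteq> f g'\<close>, so it must not be shortest. The only possible shortcut has length two and
  runs through the fibre of some \<open>g''\<close> with \<open>f g'' = a = h'\<close> and \<open>f g = f g'\<close>. This forces \<open>n = 2\<close>, at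
  most one element of \<open>X\<close> in each fibre other than that of \<open>g\<close>, and none in the fibre of \<open>g''\<close>.
\<close>

section \<open>Shortest paths and general position\<close>

lemma vpath_with_proj_iff:
  "vpath p (with_proj G) \<longleftrightarrow>
    set p \<subseteq> pverts G \<and> set (vwalk_arcs p) \<subseteq> parcs G \<and> p \<noteq> [] \<and> distinct p"
  by (auto simp: vpath_def vwalk_def)

lemma list_length_cases_le_3:
  assumes "length q \<le> 3"
  obtains "q = []" | a where "q = [a]" | a b where "q = [a, b]" | a b c where "q = [a, b, c]"
proof -
  have "length q = 0 \<or> length q = Suc 0 \<or> length q = Suc (Suc 0) \<or> length q = Suc (Suc (Suc 0))"
    using assms by arith
  then show thesis using that by (auto simp: length_Suc_conv)
qed

lemma shortest_vpath_2:
  assumes "{x, y, z} \<subseteq> pverts G" "distinct [x, y, z]"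
    and "(x, y) \<in> parcs G" "(y, z) \<in> parcs G" "(x, z) \<notin> parcs G"
  shows "shortest_vpath [x, y, z] G"
  unfolding shortest_vpath_def
proof (intro conjI allI impI)
  show "vpath [x, y, z] (with_proj G)" using assms by (simp add: vpath_with_proj_iff)
next
  fix q assume q: "vpath q (with_proj G) \<and> hd q = hd [x, y, z] \<and> last q = last [x, y, z]"
  show "vwalk_length [x, y, z] \<le> vwalk_length q"
  proof (rule ccontr)
    assume "\<not> ?thesis"
    then have "length q \<le> 3" "length q \<noteq> 3" by auto
    then show False using q assms
      by (elim list_length_cases_le_3) (auto simp: vpath_with_proj_iff)
  qed
qed

text \<open>A shorter path would be a single vertex, an arc or a detour through one common neighbour
  of the ends.\<close>

lemma shortest_vpath_3:
  assumes "{w, x, y, z} \<subseteq> pverts G" "distinct [w, x, y, z]"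
    and "(w, x) \<in> parcs G" "(x, y) \<in> parcs G" "(y, z) \<in> parcs G"
    and "(w, z) \<notin> parcs G" "\<And>u. (w, u) \<in> parcs G \<Longrightarrow> (u, z) \<notin> parcs G"
  shows "shortest_vpath [w, x, y, z] G"
  unfolding shortest_vpath_def
proof (intro conjI allI impI)
  show "vpath [w, x, y, z] (with_proj G)" using assms by (simp add: vpath_with_proj_iff)
next
  fix q assume q: "vpath q (with_proj G) \<and> hd q = hd [w, x, y, z] \<and> last q = last [w, x, y, z]"
  show "vwalk_length [w, x, y, z] \<le> vwalk_length q"
  proof (rule ccontr)
    assume "\<not> ?thesis"
    then have "length q \<le> 3" by auto
    then show False using q assms
      by (elim list_length_cases_le_3) (auto simp: vpath_with_proj_iff)
  qed
qed

text \<open>Deleting \<open>v\<close> would leave a shorter path with the same ends.\<close>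

lemma shortest_vpath_no_chord:
  assumes "shortest_vpath (xs @ a # v # b # ys) G"
  shows "(a, b) \<notin> parcs G"
proof
  assume ab: "(a, b) \<in> parcs G"
  let ?p = "(xs @ [a]) @ v # b # ys" and ?q = "(xs @ [a]) @ b # ys"
  have "vpath ?p (with_proj G)" using assms by (simp add: shortest_vpath_def)
  then have "vpath ?q (with_proj G)"
    using ab unfolding vpath_with_proj_iff by (subst (asm) vwalk_arcs_append, simp, simp,
        subst vwalk_arcs_append) auto
  moreover have "hd ?q = hd ?p" "last ?q = last ?p" by (cases xs; simp)+
  moreover have "shortest_vpath ?p G" using assms by simp
  ultimately have "vwalk_length ?p \<le> vwalk_length ?q"
    unfolding shortest_vpath_def by metis
  then show False by simp
qed

lemma inner_vertex_neighbours:
  assumes "vpath p (with_proj G)" "v \<in> set p" "v \<noteq> hd p" "v \<noteq> last p"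
  obtains xs a b ys where "p = xs @ a # v # b # ys" "(a, v) \<in> parcs G" "(v, b) \<in> parcs G" "a \<noteq> b"
proof -
  obtain us ws where p: "p = us @ v # ws" using assms(2) by (meson split_list)
  have "us \<noteq> []" "ws \<noteq> []" using assms(3,4) p by auto
  then obtain xs a b ys where us: "us = xs @ [a]" and ws: "ws = b # ys"
    by (meson list.exhaust rev_exhaust)
  have "set (vwalk_arcs ((xs @ [a]) @ v # b # ys)) \<subseteq> parcs G" "a \<noteq> b"
    using assms(1) p us ws by (auto simp: vpath_with_proj_iff)
  then have "(a, v) \<in> parcs G" "(v, b) \<in> parcs G"
    by (subst (asm) vwalk_arcs_append; simp)+
  then show thesis using that p us ws \<open>a \<noteq> b\<close> by simp
qed

lemma general_position_set_no_three:
  assumes "general_position_set G X" "shortest_vpath p G" "{x, y, z} \<subseteq> set p \<inter> X"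
  shows "\<not> distinct [x, y, z]"
proof
  assume "distinct [x, y, z]"
  then have "card {x, y, z} = 3" by simp
  moreover have "card {x, y, z} \<le> card (set p \<inter> X)" using assms(3) by (intro card_mono) auto
  ultimately show False using assms(1,2) by (fastforce simp: general_position_set_def)
qed

section \<open>Fibres of the product of complete graphs\<close>

locale complete_sierpinski =
  fixes G :: "'a pair_pre_digraph" and H :: "'b pair_pre_digraph" and m n :: nat
  assumes m2: "m \<ge> 2" and n2: "n \<ge> 2"
    and G: "complete_digraph m (with_proj G)" and H: "complete_digraph n (with_proj H)"
begin

abbreviation V where "V \<equiv> pverts G"
abbreviation W where "W \<equiv> pverts H"

lemma finite_V: "finite V" and card_V: "card V = m"
  and finite_W: "finite W" and card_W: "card W = n"
  using G H by (auto simp: complete_digraph_pair_def)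

lemma pverts_product: "pverts (sierpinski_product G f H) = V \<times> W"
  by (simp add: sierpinski_product_def)

text \<open>Since \<open>G\<close> has no loops, the test \<open>g = g'\<close> separates the two
  kinds of arcs: fibres are cliques, and exactly one edge joins any two of them.\<close>

lemma arc_product_iff:
  "((g, h), (g', h')) \<in> parcs (sierpinski_product G f H) \<longleftrightarrow> g \<in> V \<and> g' \<in> V \<and>
    (if g = g' then h \<in> W \<and> h' \<in> W \<and> h \<noteq> h' else h = f g' \<and> h' = f g)"
  using G H by (auto simp: sierpinski_product_def complete_digraph_pair_def)

section \<open>Upper bound for arbitrary \<open>f\<close>\<close>

lemma full_fibre_excludes:
  assumes f: "f \<in> V \<rightarrow> W"
    and X: "general_position_set (sierpinski_product G f H) X"
    and full: "{g} \<times> W \<subseteq> X" and g: "g \<in> V" and x: "(g', h') \<in> X" and ne: "g' \<noteq> g"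
  shows "h' \<noteq> f g" "f g' = f g" "\<exists>g''\<in>V. f g'' = h'" "W = {f g, h'}"
proof -
  let ?S = "sierpinski_product G f H"
  have XVW: "X \<subseteq> V \<times> W" using X by (simp add: general_position_set_def pverts_product)
  then have g': "g' \<in> V" and h': "h' \<in> W" using x by auto
  have fg: "f g \<in> W" and fg': "f g' \<in> W" using f g g' by auto
  have "\<not> W \<subseteq> {f g'}"
    using card_mono[of "{f g'}" W] card_W n2 by auto
  then obtain a where a: "a \<in> W" "a \<noteq> f g'" by auto
  show h'f: "h' \<noteq> f g"
  proof
    assume eq: "h' = f g"
    \<comment> \<open>By \<open>eq\<close>, \<open>(g', h')\<close> is an end of the edge joining
      the two fibres, so this path lies entirely in \<open>X\<close>.\<close>
    have "shortest_vpath [(g, a), (g, f g'), (g', h')] ?S"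
      using a g g' h' fg' ne eq
      by (intro shortest_vpath_2) (auto simp: pverts_product arc_product_iff)
    moreover have "(g, a) \<in> X" "(g, f g') \<in> X" using full a fg' by auto
    ultimately show False
      using general_position_set_no_three[OF X, of _ "(g, a)" "(g, f g')" "(g', h')"] x a ne
      by fastforce
  qed
  have shortcut: "f g' = f g \<and> h' = b \<and> (\<exists>g''\<in>V. f g'' = b)" if b: "b \<in> W" "b \<noteq> f g'" for b
  proof (rule ccontr)
    assume neg: "\<not> ?thesis"
    \<comment> \<open>A common neighbour in the fibre of \<open>g\<close> needs
      \<open>h' = f g\<close>, one in the fibre of \<open>g'\<close> needs \<open>b = f g'\<close>.
      One in a third fibre, over \<open>g''\<close>, needs \<open>b = f g'' = h'\<close> and
      \<open>f g = f g'\<close>, against \<open>neg\<close>.\<close>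
    have "((g, b), u) \<in> parcs ?S \<Longrightarrow> (u, (g', h')) \<notin> parcs ?S" for u
      using neg b ne h'f by (cases u) (auto simp: arc_product_iff split: if_splits)
    then have "shortest_vpath [(g, b), (g, f g'), (g', f g), (g', h')] ?S"
      using b g g' h' fg fg' ne h'f
      by (intro shortest_vpath_3) (auto simp: pverts_product arc_product_iff)
    moreover have "(g, b) \<in> X" "(g, f g') \<in> X" using full b fg' by auto
    ultimately show False
      using general_position_set_no_three[OF X, of _ "(g, b)" "(g, f g')" "(g', h')"] x b ne
      by fastforce
  qed
  show "f g' = f g" "\<exists>g''\<in>V. f g'' = h'" using shortcut[OF a] by auto
  then have "b = f g \<or> b = h'" if "b \<in> W" for b using shortcut[of b] that by metis
  then show "W = {f g, h'}" using fg h' by blast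
qed

lemma card_general_position_set_le:
  assumes f: "f \<in> V \<rightarrow> W" and X: "general_position_set (sierpinski_product G f H) X"
  shows "card X \<le> m * (n - 1)"
proof -
  have XVW: "X \<subseteq> V \<times> W" using X by (simp add: general_position_set_def pverts_product)
  show ?thesis
  proof (cases "\<exists>g\<in>V. {g} \<times> W \<subseteq> X")
    case False
    from XVW have "X = (SIGMA g:V. X `` {g})" by auto
    moreover have XW: "X `` {g} \<subseteq> W" for g using XVW by auto
    then have fin: "finite (X `` {g})" for g using finite_W finite_subset by blast
    ultimately have "card X = (\<Sum>g\<in>V. card (X `` {g}))"
      using card_SigmaI[OF finite_V, of "\<lambda>g. X `` {g}"] by auto
    \<comment> \<open>No fibre is full, so each misses a point.\<close>
    also have "\<dots> \<le> (\<Sum>g\<in>V. n - 1)"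
    proof (rule sum_mono)
      fix g assume "g \<in> V"
      then have "X `` {g} \<subset> W" using False XW by blast
      then have "card (X `` {g}) < n"
        using psubset_card_mono[OF finite_W] card_W by blast
      then show "card (X `` {g}) \<le> n - 1" by simp
    qed
    finally show ?thesis by (simp add: card_V)
  next
    case True
    then obtain g where g: "g \<in> V" and full: "{g} \<times> W \<subseteq> X" by auto
    note excl = full_fibre_excludes[OF f X full g]
    show ?thesis
    proof (cases "X \<subseteq> {g} \<times> W")
      case True
      then have "card X \<le> n"
        using card_mono[OF _ True] finite_W by (simp add: card_cartesian_product card_W)
      also have "n \<le> 2 * (n - 1)" using n2 by simp
      also have "\<dots> \<le> m * (n - 1)" using m2 by (rule mult_le_mono1)
      finally show ?thesis .
    next
      case False
      then obtain g' h' where x: "(g', h') \<in> X" "g' \<noteq> g" using XVW by auto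
      obtain g'' where g'': "g'' \<in> V" "f g'' = h'" using excl(3)[OF x] by auto
      have h': "h' \<noteq> f g" and W: "W = {f g, h'}" using excl(1,4)[OF x] .
      have n: "n = 2" using card_W W h' by auto
      have gg'': "g \<noteq> g''" using g'' h' by auto
      \<comment> \<open>Outside the fibre of \<open>g\<close>, second coordinates differ from
        \<open>f g\<close>, hence equal \<open>h'\<close>. A point over \<open>g''\<close> would
        give \<open>f g'' = f g\<close>, but \<open>f g'' = h'\<close>.\<close>
      have "X \<subseteq> {g} \<times> W \<union> (V - {g, g''}) \<times> {h'}"
      proof (rule subrelI)
        fix a b assume ab: "(a, b) \<in> X"
        show "(a, b) \<in> {g} \<times> W \<union> (V - {g, g''}) \<times> {h'}"
          using ab XVW excl(1,2)[OF ab] W g'' h' by auto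
      qed
      then have "card X \<le> card ({g} \<times> W \<union> (V - {g, g''}) \<times> {h'})"
        using finite_V finite_W by (intro card_mono) auto
      also have "\<dots> \<le> card ({g} \<times> W) + card ((V - {g, g''}) \<times> {h'})" by (rule card_Un_le)
      also have "\<dots> = n + (m - 2)"
        using g g'' gg'' by (simp add: card_cartesian_product card_W card_V card_Diff_subset)
      finally show ?thesis using n m2 by simp
    qed
  qed
qed

section \<open>Sharpness for constant \<open>f\<close>\<close>

lemma general_position_set_constant:
  assumes f: "\<And>g. g \<in> V \<Longrightarrow> f g = h"
  shows "general_position_set (sierpinski_product G f H) (V \<times> (W - {h}))"
  unfolding general_position_set_def
proof (intro conjI allI impI)
  let ?S = "sierpinski_product G f H" and ?X = "V \<times> (W - {h})"
  show "?X \<subseteq> pverts ?S" by (auto simp: pverts_product)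
  fix p assume p: "shortest_vpath p ?S"
  have "set p \<inter> ?X \<subseteq> {hd p, last p}"
  proof (rule ccontr)
    assume "\<not> ?thesis"
    then obtain v where v: "v \<in> set p" "v \<in> ?X" "v \<noteq> hd p" "v \<noteq> last p" by blast
    have "vpath p (with_proj ?S)" using p by (simp add: shortest_vpath_def)
    then obtain xs a b ys where nb: "p = xs @ a # v # b # ys" "(a, v) \<in> parcs ?S"
      "(v, b) \<in> parcs ?S" "a \<noteq> b"
      using inner_vertex_neighbours v by metis
    \<comment> \<open>Arcs leaving a fibre start at second coordinate \<open>h\<close>, so
      \<open>a\<close> and \<open>b\<close> both lie in the clique containing
      \<open>v\<close>.\<close>
    have "(a, b) \<in> parcs ?S"
      using nb(2-4) v(2) f by (cases a; cases b; cases v) (auto simp: arc_product_iff split: if_splits)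
    then show False using shortest_vpath_no_chord p nb(1) by metis
  qed
  then have "card (set p \<inter> ?X) \<le> card {hd p, last p}" by (intro card_mono) auto
  also have "\<dots> \<le> 2" by (simp add: card_insert_if)
  finally show "card (set p \<inter> ?X) \<le> 2" .
qed

lemma finite_general_position_sets:
  "finite {X. general_position_set (sierpinski_product G f H) X}"
  by (rule finite_subset[of _ "Pow (V \<times> W)"])
    (auto simp: general_position_set_def pverts_product finite_V finite_W)

lemma gp_product_le:
  assumes "f \<in> V \<rightarrow> W"
  shows "gp (sierpinski_product G f H) \<le> m * (n - 1)"
proof -
  \<comment> \<open>The empty set ensures that the maximum ranges over a nonempty family.\<close>
  have "general_position_set (sierpinski_product G f H) {}" by (simp add: general_position_set_def)
  then show ?thesis
    unfolding gp_def using finite_general_position_sets card_general_position_set_le[OF assms]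
    by (subst Max_le_iff) auto
qed

text \<open>The constant function is restricted to \<open>V\<close> because \<open>gp_S\<close>
  ranges over extensional functions.\<close>

lemma gp_product_constant:
  assumes "h \<in> W"
  shows "gp (sierpinski_product G (\<lambda>g\<in>V. h) H) = m * (n - 1)"
proof (rule antisym)
  show "gp (sierpinski_product G (\<lambda>g\<in>V. h) H) \<le> m * (n - 1)"
    using assms by (intro gp_product_le) auto
  have "card (V \<times> (W - {h})) = m * (n - 1)"
    using assms finite_W by (simp add: card_cartesian_product card_V card_W)
  then show "m * (n - 1) \<le> gp (sierpinski_product G (\<lambda>g\<in>V. h) H)"
    unfolding gp_def using finite_general_position_sets
    by (intro Max_ge) (auto intro!: image_eqI[OF sym] general_position_set_constant)
qed

lemma gp_S_complete: "gp_S G H = m * (n - 1)"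
proof -
  have "W \<noteq> {}" using card_W n2 by auto
  then obtain h where "h \<in> W" by auto
  then have "m * (n - 1) \<in> (\<lambda>f. gp (sierpinski_product G f H)) ` (V \<rightarrow>\<^sub>E W)"
    by (intro image_eqI[where x = "\<lambda>g\<in>V. h"]) (auto simp: gp_product_constant)
  moreover have "gp (sierpinski_product G f H) \<le> m * (n - 1)" if "f \<in> V \<rightarrow>\<^sub>E W" for f
    using that by (intro gp_product_le) auto
  ultimately show ?thesis
    unfolding gp_S_def using finite_PiE[OF finite_V finite_W] by (intro Max_eqI) blast+
qed

end

theorem theorem5p1:
  fixes G :: "'a pair_pre_digraph" and H :: "'b pair_pre_digraph" and m n :: nat
  assumes "m \<ge> 2" and "n \<ge> 2"
    and "complete_digraph m (with_proj G)" and "complete_digraph n (with_proj H)"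
  shows "gp_S G H = m * (n - 1)"
  using assms by (intro complete_sierpinski.gp_S_complete complete_sierpinski.intro)

end
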